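(* Let $q$ be a power of a prime $p$, $n$ a positive integer, and $S$ a subset of $\mathbb{F}_{q^n}$ containing $0$. Let $h,k\in\mathbb{F}_{q^n}[x]$ be polynomials with $h(0)\neq 0$ and $k(0)=0$, and let $\lambda\in\mathbb{F}_{q^n}[x]$ be a polynomial satisfying (1) $h(\lambda(\mathbb{F}_{q^n}))\subseteq S$, and (2) $\lambda(a\alpha)=k(a)\lambda(\alpha)$ for all $a\in S$ and all $\alpha\in\mathbb{F}_{q^n}$. Suppose $f(x)=xh(\lambda(x))$ permutes $\mathbb{F}_{q^n}$ (so that $g(x)=xk(h(x))$ induces a permutation of $\lambda(\mathbb{F}_{q^n})$), and let $g^{-1}$ be the compositional inverse of $g$ on $\lambda(\mathbb{F}_{q^n})$. Then the compositional inverse of $f$ on $\mathbb{F}_{q^n}$ is given by $$f^{-1}(x)=\frac{x}{h(g^{-1}(\lambda(x)))}.$$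
   Context: $\mathbb{F}_{q^n}$ is the finite field with $q^n$ elements; polynomials are identified with the functions they induce on $\mathbb{F}_{q^n}$. It is known (Akbary–Ghioca–Wang) that under these hypotheses $f$ permutes $\mathbb{F}_{q^n}$ if and only if $g$ induces a permutation of $\lambda(\mathbb{F}_{q^n})$. *)

theory Defs
  imports "HOL-Computational_Algebra.Computational_Algebra"
begin

end

theory Submission
  imports Defs
begin

text \<open>Condition (2) with \<open>a = h (\<lambda> x)\<close> gives \<open>\<lambda> \<circ> f = g \<circ> \<lambda>\<close>. Since \<open>f\<close> is onto, so is \<open>g\<close> on the finite
  range of \<open>\<lambda>\<close>, hence it is bijective there. Writing \<open>x = f y\<close>, we get \<open>g\<^sup>-\<^sup>1 (\<lambda> x) = \<lambda> y\<close>, and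
  \<open>x = y h (\<lambda> y)\<close> can be solved for \<open>y\<close>: \<open>h (\<lambda> y) = 0\<close> would force \<open>f y = 0 = f 0\<close>, so \<open>y = 0\<close>,
  contradicting \<open>h (\<lambda> 0) = h 0 \<noteq> 0\<close>.\<close>

theorem corollary3p1:
  fixes p m q n :: nat
    and S :: "'a :: {field, finite} set"
    and h k lam f g :: "'a poly"
  assumes "prime p" and "0 < m" and "q = p ^ m" and "0 < n"
    and "card (UNIV :: 'a set) = q ^ n"
    and "0 \<in> S"
    and "poly h 0 \<noteq> 0" and "poly k 0 = 0"
    and "poly h ` range (poly lam) \<subseteq> S"
    and "\<And>a \<alpha>. a \<in> S \<Longrightarrow> poly lam (a * \<alpha>) = poly k a * poly lam \<alpha>"
    and "f = [:0, 1:] * pcompose h lam"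
    and "g = [:0, 1:] * pcompose k h"
    and "bij (poly f)"
  shows "bij_betw (poly g) (range (poly lam)) (range (poly lam))
    \<and> (\<forall>x. poly h (inv_into (range (poly lam)) (poly g) (poly lam x)) \<noteq> 0
          \<and> inv (poly f) x = x / poly h (inv_into (range (poly lam)) (poly g) (poly lam x)))"
proof -
  let ?L = "range (poly lam)"
  have f_eq: "poly f x = x * poly h (poly lam x)" for x
    by (simp add: assms(11) poly_pcompose)
  have g_eq: "poly g x = x * poly k (poly h x)" for x
    by (simp add: assms(12) poly_pcompose)
  have inj: "inj (poly f)" and surj: "surj (poly f)"
    using assms(13) by (auto simp: bij_def)
  have comm: "poly lam (poly f x) = poly g (poly lam x)" for x
  proof -
    have "poly h (poly lam x) \<in> S" using assms(9) by auto
    from assms(10)[OF this, of x] show ?thesis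
      by (simp add: f_eq g_eq mult.commute)
  qed
  have "poly g ` ?L = poly lam ` range (poly f)"
    by (simp add: image_image comm)
  then have onto: "poly g ` ?L = ?L" using surj by simp
  \<comment> \<open>Image and domain are the same finite set, so their cardinalities agree.\<close>
  then have g_inj: "inj_on (poly g) ?L" by (intro eq_card_imp_inj_on) simp_all
  \<comment> \<open>Condition (2) at \<open>a = 0\<close>, \<open>\<alpha> = 0\<close>, where the
    factor \<open>poly k 0\<close> vanishes. This turns \<open>h (lam 0)\<close> into
    \<open>h 0\<close> below.\<close>
  have lam0: "poly lam 0 = 0"
    using assms(10)[OF assms(6), of 0] assms(8) by simp
  have h_nz: "poly h (poly lam y) \<noteq> 0" for y
  proof
    assume *: "poly h (poly lam y) = 0"
    then have "poly f y = poly f 0" by (simp add: f_eq)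
    then have "y = 0" using inj by (simp add: inj_eq)
    with * lam0 assms(7) show False by simp
  qed
  have "poly h (inv_into ?L (poly g) (poly lam x)) \<noteq> 0
      \<and> inv (poly f) x = x / poly h (inv_into ?L (poly g) (poly lam x))" for x
  proof -
    obtain y where x: "x = poly f y" using surj by (metis surjD)
    \<comment> \<open>By \<open>comm\<close>, \<open>poly lam y\<close> is a preimage of
      \<open>poly lam x\<close> in \<open>?L\<close>; by \<open>g_inj\<close> it is the only one, so
      \<open>inv_into\<close> must choose it.\<close>
    have "inv_into ?L (poly g) (poly lam x) = poly lam y"
      by (simp add: x comm inv_into_f_f[OF g_inj])
    moreover have "inv (poly f) x = y" by (simp add: x inv_f_f[OF inj])
    moreover have "x = y * poly h (poly lam y)" by (simp add: x f_eq)
    ultimately show ?thesis using h_nz[of y] by simp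
  qed
  with onto g_inj show ?thesis by (simp add: bij_betw_def)
qed

end
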